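(* There exist almost contact metric manifolds which do not admit the number $M_S(2n+1)=1+n(2n-1)$ of linearly independent special quadratic first integrals; that is, there exist an integer $n\ge 1$ and an almost contact metric manifold $(M,\varphi,\xi,\eta,g)$ of dimension $2n+1$ such that there are no $1+n(2n-1)$ linearly independent (over $\mathbb{R}$) special quadratic first integrals for the geodesics of the Levi-Civita connection of $g$.
   Context: All objects are $C^\infty$; manifolds are connected. An almost contact metric manifold is a $(2n+1)$-dimensional manifold $M$ ($n\ge 1$) with a $(1,1)$-tensor field $\varphi$, a vector field $\xi$, a 1-form $\eta$ and a Riemannian metric $g$ such that $\varphi^2=-I+\eta\otimes\xi$, $\eta(\xi)=1$, $\eta\circ\varphi=0$, $\varphi(\xi)=0$, $\eta(X)=g(X,\xi)$ and $g(\varphi X,\varphi Y)=g(X,Y)-\eta(X)\eta(Y)$ for all vector fields $X,Y$. For a manifold $M$ with a symmetric linear connection $\nabla$, a quadratic first integral for the geodesics of $\nabla$ is $\mathcal{F}=a_{ij}\frac{dx^i}{dt}\frac{dx^j}{dt}$, where $a=(a_{ij})$ is a symmetric $(0,2)$-tensor field on $M$ satisfying $a_{ij:k}+a_{jk:i}+a_{ki:j}=0$, the colon denoting covariant derivative with respect to $\nabla$. It is special (SQFI) if $a_{ij:k}=0$, i.e. $\nabla a=0$. The number $M_S(m)=1+\frac{(m-2)(m-1)}{2}$ is the maximal number of linearly independent SQFI that a non-flat $m$-dimensional Riemannian manifold may admit; for $m=2n+1$ it equals $1+n(2n-1)$. *)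

theory Defs
  imports "HOL-Analysis.Analysis"
begin

text \<open>
  \<open>\<real>\<^sup>m\<close> is \<^term>\<open>Euclidean_space m\<close>, i.e. the functions \<^typ>\<open>nat \<Rightarrow> real\<close> that vanish at all
  indices \<open>\<ge> m\<close>; coordinates are thus numbered \<open>0, \<dots>, m - 1\<close>, and the dimension is an ordinary
  natural number.
\<close>

section \<open>Smooth functions on open subsets of \<open>\<real>\<^sup>m\<close>\<close>

definition partial :: "nat \<Rightarrow> ((nat \<Rightarrow> real) \<Rightarrow> real) \<Rightarrow> (nat \<Rightarrow> real) \<Rightarrow> real" where
  "partial i f u = deriv (\<lambda>t. f (u(i := t))) (u i)"

text \<open>All iterated partial derivatives exist and are continuous (\<open>U\<close> is meant to be open).\<close>

definition smooth_on :: "nat \<Rightarrow> (nat \<Rightarrow> real) set \<Rightarrow> ((nat \<Rightarrow> real) \<Rightarrow> real) \<Rightarrow> bool" where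
  "smooth_on m U f \<longleftrightarrow>
    (\<forall>is. set is \<subseteq> {..<m} \<longrightarrow>
      continuous_map (subtopology (Euclidean_space m) U) euclideanreal (foldr partial is f) \<and>
      (\<forall>u\<in>U. \<forall>i<m. (\<lambda>t. foldr partial is f (u(i := t))) differentiable at (u i)))"

section \<open>Smooth manifolds\<close>

record 'p chart =
  cdom :: "'p set"
  cmap :: "'p \<Rightarrow> nat \<Rightarrow> real"

record 'p manifold =
  mdim :: nat
  mtop :: "'p topology"
  atlas :: "'p chart set"

abbreviation points :: "'p manifold \<Rightarrow> 'p set" where
  "points M \<equiv> topspace (mtop M)"

definition cinv :: "'p chart \<Rightarrow> (nat \<Rightarrow> real) \<Rightarrow> 'p" where
  "cinv c = inv_into (cdom c) (cmap c)"

abbreviation coord :: "'p chart \<Rightarrow> nat \<Rightarrow> 'p \<Rightarrow> real" where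
  "coord c i \<equiv> (\<lambda>q. cmap c q i)"

definition is_chart :: "nat \<Rightarrow> 'p topology \<Rightarrow> 'p chart \<Rightarrow> bool" where
  "is_chart m T c \<longleftrightarrow>
    openin T (cdom c) \<and>
    openin (Euclidean_space m) (cmap c ` cdom c) \<and>
    homeomorphic_map (subtopology T (cdom c))
      (subtopology (Euclidean_space m) (cmap c ` cdom c)) (cmap c)"

definition smooth_manifold :: "'p manifold \<Rightarrow> bool" where
  "smooth_manifold M \<longleftrightarrow>
    points M \<noteq> {} \<and> Hausdorff_space (mtop M) \<and> second_countable (mtop M) \<and>
    connected_space (mtop M) \<and>
    (\<forall>c\<in>atlas M. is_chart (mdim M) (mtop M) c) \<and>
    (\<Union>c\<in>atlas M. cdom c) = points M \<and>
    (\<forall>c\<in>atlas M. \<forall>d\<in>atlas M. \<forall>i<mdim M.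
      smooth_on (mdim M) (cmap c ` (cdom c \<inter> cdom d)) (coord d i \<circ> cinv c))"

text \<open>Smoothness of a real function on an open set \<open>W\<close> of the manifold.\<close>

definition smooth_fun :: "'p manifold \<Rightarrow> 'p set \<Rightarrow> ('p \<Rightarrow> real) \<Rightarrow> bool" where
  "smooth_fun M W f \<longleftrightarrow>
    (\<forall>c\<in>atlas M. smooth_on (mdim M) (cmap c ` (cdom c \<inter> W)) (f \<circ> cinv c))"

definition smooth_near :: "'p manifold \<Rightarrow> 'p \<Rightarrow> ('p \<Rightarrow> real) \<Rightarrow> bool" where
  "smooth_near M p f \<longleftrightarrow> (\<exists>W. openin (mtop M) W \<and> p \<in> W \<and> smooth_fun M W f)"

text \<open>\<open>\<partial>f/\<partial>x\<^sup>i\<close> at \<open>p\<close>, for the coordinates \<open>x\<close> of the chart \<open>c\<close>.\<close>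

definition pd :: "'p chart \<Rightarrow> nat \<Rightarrow> ('p \<Rightarrow> real) \<Rightarrow> 'p \<Rightarrow> real" where
  "pd c i f p = partial i (f \<circ> cinv c) (cmap c p)"

section \<open>Tangent vectors and tensor fields\<close>

text \<open>
  A tangent vector at \<open>p\<close> is the operator \<open>f \<mapsto> \<Sum>\<^sub>i w\<^sub>i \<partial>f/\<partial>x\<^sup>i(p)\<close> on the functions that are smooth
  near \<open>p\<close>, for some chart \<open>x\<close> at \<open>p\<close>. On all other functions it is set to \<open>0\<close>, so that equality of
  tangent vectors is equality of operators.
\<close>

type_synonym 'p tvec = "('p \<Rightarrow> real) \<Rightarrow> real"

definition coord_vec :: "'p manifold \<Rightarrow> 'p chart \<Rightarrow> nat \<Rightarrow> 'p \<Rightarrow> 'p tvec" where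
  "coord_vec M c i p = (\<lambda>f. if smooth_near M p f then pd c i f p else 0)"

definition tangent_space :: "'p manifold \<Rightarrow> 'p \<Rightarrow> 'p tvec set" where
  "tangent_space M p =
    {v. \<exists>c\<in>atlas M. p \<in> cdom c \<and>
        (\<exists>w. v = (\<lambda>f. \<Sum>i<mdim M. w i * coord_vec M c i p f))}"

definition lincomb :: "real \<Rightarrow> 'p tvec \<Rightarrow> real \<Rightarrow> 'p tvec \<Rightarrow> 'p tvec" where
  "lincomb r v s w = (\<lambda>f. r * v f + s * w f)"

definition vector_field :: "'p manifold \<Rightarrow> ('p \<Rightarrow> 'p tvec) \<Rightarrow> bool" where
  "vector_field M X \<longleftrightarrow>
    (\<forall>p\<in>points M. X p \<in> tangent_space M p) \<and>
    (\<forall>c\<in>atlas M. \<forall>i<mdim M. smooth_fun M (cdom c) (\<lambda>p. X p (coord c i)))"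

definition one_form :: "'p manifold \<Rightarrow> ('p \<Rightarrow> 'p tvec \<Rightarrow> real) \<Rightarrow> bool" where
  "one_form M \<omega> \<longleftrightarrow>
    (\<forall>p\<in>points M. \<forall>v\<in>tangent_space M p. \<forall>w\<in>tangent_space M p. \<forall>r s.
      \<omega> p (lincomb r v s w) = r * \<omega> p v + s * \<omega> p w) \<and>
    (\<forall>c\<in>atlas M. \<forall>i<mdim M. smooth_fun M (cdom c) (\<lambda>p. \<omega> p (coord_vec M c i p)))"

definition tensor_field_11 :: "'p manifold \<Rightarrow> ('p \<Rightarrow> 'p tvec \<Rightarrow> 'p tvec) \<Rightarrow> bool" where
  "tensor_field_11 M \<phi> \<longleftrightarrow>
    (\<forall>p\<in>points M. \<forall>v\<in>tangent_space M p. \<phi> p v \<in> tangent_space M p) \<and>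
    (\<forall>p\<in>points M. \<forall>v\<in>tangent_space M p. \<forall>w\<in>tangent_space M p. \<forall>r s.
      \<phi> p (lincomb r v s w) = lincomb r (\<phi> p v) s (\<phi> p w)) \<and>
    (\<forall>c\<in>atlas M. \<forall>i<mdim M. \<forall>j<mdim M.
      smooth_fun M (cdom c) (\<lambda>p. \<phi> p (coord_vec M c j p) (coord c i)))"

text \<open>The component \<open>a\<^bsub>ij\<^esub>\<close> of a \<open>(0,2)\<close>-tensor field in the chart \<open>c\<close>.\<close>

definition comp02 ::
    "'p manifold \<Rightarrow> ('p \<Rightarrow> 'p tvec \<Rightarrow> 'p tvec \<Rightarrow> real) \<Rightarrow> 'p chart \<Rightarrow> nat \<Rightarrow> nat \<Rightarrow> 'p \<Rightarrow> real" where
  "comp02 M a c i j p = a p (coord_vec M c i p) (coord_vec M c j p)"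

definition symmetric_tensor_field_02 ::
    "'p manifold \<Rightarrow> ('p \<Rightarrow> 'p tvec \<Rightarrow> 'p tvec \<Rightarrow> real) \<Rightarrow> bool" where
  "symmetric_tensor_field_02 M a \<longleftrightarrow>
    (\<forall>p\<in>points M. \<forall>v\<in>tangent_space M p. \<forall>w\<in>tangent_space M p. a p v w = a p w v) \<and>
    (\<forall>p\<in>points M. \<forall>u\<in>tangent_space M p. \<forall>v\<in>tangent_space M p. \<forall>w\<in>tangent_space M p. \<forall>r s.
      a p (lincomb r u s v) w = r * a p u w + s * a p v w) \<and>
    (\<forall>c\<in>atlas M. \<forall>i<mdim M. \<forall>j<mdim M. smooth_fun M (cdom c) (comp02 M a c i j))"

definition riemannian_metric ::
    "'p manifold \<Rightarrow> ('p \<Rightarrow> 'p tvec \<Rightarrow> 'p tvec \<Rightarrow> real) \<Rightarrow> bool" where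
  "riemannian_metric M g \<longleftrightarrow>
    symmetric_tensor_field_02 M g \<and>
    (\<forall>p\<in>points M. \<forall>v\<in>tangent_space M p. v \<noteq> (\<lambda>_. 0) \<longrightarrow> g p v v > 0)"

section \<open>Almost contact metric manifolds\<close>

text \<open>
  The identities between tensor fields are stated at each point; for tensor fields this is the same
  as stating them for all vector fields.
\<close>

definition almost_contact_metric_manifold ::
    "nat \<Rightarrow> 'p manifold \<Rightarrow> ('p \<Rightarrow> 'p tvec \<Rightarrow> 'p tvec) \<Rightarrow> ('p \<Rightarrow> 'p tvec) \<Rightarrow>
      ('p \<Rightarrow> 'p tvec \<Rightarrow> real) \<Rightarrow> ('p \<Rightarrow> 'p tvec \<Rightarrow> 'p tvec \<Rightarrow> real) \<Rightarrow> bool" where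
  "almost_contact_metric_manifold n M \<phi> \<xi> \<eta> g \<longleftrightarrow>
    n \<ge> 1 \<and> smooth_manifold M \<and> mdim M = 2 * n + 1 \<and>
    tensor_field_11 M \<phi> \<and> vector_field M \<xi> \<and> one_form M \<eta> \<and> riemannian_metric M g \<and>
    (\<forall>p\<in>points M.
      \<eta> p (\<xi> p) = 1 \<and> \<phi> p (\<xi> p) = (\<lambda>_. 0) \<and>
      (\<forall>X\<in>tangent_space M p.
        \<phi> p (\<phi> p X) = lincomb (- 1) X (\<eta> p X) (\<xi> p) \<and>
        \<eta> p (\<phi> p X) = 0 \<and>
        \<eta> p X = g p X (\<xi> p) \<and>
        (\<forall>Y\<in>tangent_space M p. g p (\<phi> p X) (\<phi> p Y) = g p X Y - \<eta> p X * \<eta> p Y)))"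

section \<open>Linear connections and quadratic first integrals\<close>

text \<open>
  A linear connection is given by its coefficients, \<open>\<Gamma> c k i j p = \<Gamma>\<^sup>k\<^bsub>ij\<^esub>(p)\<close> in the chart \<open>c\<close>, with
  the usual transformation law between the coordinates \<open>x\<close> of \<open>c\<close> and \<open>y\<close> of \<open>d\<close>.
\<close>

type_synonym 'p connection = "'p chart \<Rightarrow> nat \<Rightarrow> nat \<Rightarrow> nat \<Rightarrow> 'p \<Rightarrow> real"

definition linear_connection :: "'p manifold \<Rightarrow> 'p connection \<Rightarrow> bool" where
  "linear_connection M \<Gamma> \<longleftrightarrow>
    (\<forall>c\<in>atlas M. \<forall>k<mdim M. \<forall>i<mdim M. \<forall>j<mdim M. smooth_fun M (cdom c) (\<Gamma> c k i j)) \<and>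
    (\<forall>c\<in>atlas M. \<forall>d\<in>atlas M. \<forall>p\<in>cdom c \<inter> cdom d.
      \<forall>k<mdim M. \<forall>i<mdim M. \<forall>j<mdim M.
        \<Gamma> d k i j p =
          (\<Sum>l<mdim M. pd c l (coord d k) p *
            (pd d i (pd d j (coord c l)) p +
             (\<Sum>r<mdim M. \<Sum>s<mdim M.
                pd d i (coord c r) p * pd d j (coord c s) p * \<Gamma> c l r s p))))"

definition symmetric_connection :: "'p manifold \<Rightarrow> 'p connection \<Rightarrow> bool" where
  "symmetric_connection M \<Gamma> \<longleftrightarrow>
    linear_connection M \<Gamma> \<and>
    (\<forall>c\<in>atlas M. \<forall>p\<in>cdom c. \<forall>k<mdim M. \<forall>i<mdim M. \<forall>j<mdim M. \<Gamma> c k i j p = \<Gamma> c k j i p)"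

text \<open>\<open>a\<^bsub>ij:k\<^esub>\<close> in the chart \<open>c\<close>.\<close>

definition cov_deriv ::
    "'p manifold \<Rightarrow> 'p connection \<Rightarrow> ('p \<Rightarrow> 'p tvec \<Rightarrow> 'p tvec \<Rightarrow> real) \<Rightarrow>
      'p chart \<Rightarrow> nat \<Rightarrow> nat \<Rightarrow> nat \<Rightarrow> 'p \<Rightarrow> real" where
  "cov_deriv M \<Gamma> a c i j k p =
    pd c k (comp02 M a c i j) p
    - (\<Sum>l<mdim M. \<Gamma> c l k i p * comp02 M a c l j p)
    - (\<Sum>l<mdim M. \<Gamma> c l k j p * comp02 M a c i l p)"

definition parallel ::
    "'p manifold \<Rightarrow> 'p connection \<Rightarrow> ('p \<Rightarrow> 'p tvec \<Rightarrow> 'p tvec \<Rightarrow> real) \<Rightarrow> bool" where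
  "parallel M \<Gamma> a \<longleftrightarrow>
    (\<forall>c\<in>atlas M. \<forall>p\<in>cdom c. \<forall>i<mdim M. \<forall>j<mdim M. \<forall>k<mdim M. cov_deriv M \<Gamma> a c i j k p = 0)"

definition levi_civita_connection ::
    "'p manifold \<Rightarrow> ('p \<Rightarrow> 'p tvec \<Rightarrow> 'p tvec \<Rightarrow> real) \<Rightarrow> 'p connection \<Rightarrow> bool" where
  "levi_civita_connection M g \<Gamma> \<longleftrightarrow> symmetric_connection M \<Gamma> \<and> parallel M \<Gamma> g"

text \<open>
  A quadratic first integral is a function \<open>F p v = a\<^bsub>ij\<^esub> v\<^sup>i v\<^sup>j\<close> on the tangent bundle, evaluated along
  a geodesic at its velocity. By polarization \<open>F\<close> determines the symmetric tensor field \<open>a\<close>.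
\<close>

definition quadratic_first_integral ::
    "'p manifold \<Rightarrow> 'p connection \<Rightarrow> ('p \<Rightarrow> 'p tvec \<Rightarrow> 'p tvec \<Rightarrow> real) \<Rightarrow>
      ('p \<Rightarrow> 'p tvec \<Rightarrow> real) \<Rightarrow> bool" where
  "quadratic_first_integral M \<Gamma> a F \<longleftrightarrow>
    symmetric_tensor_field_02 M a \<and>
    (\<forall>c\<in>atlas M. \<forall>p\<in>cdom c. \<forall>i<mdim M. \<forall>j<mdim M. \<forall>k<mdim M.
      cov_deriv M \<Gamma> a c i j k p + cov_deriv M \<Gamma> a c j k i p + cov_deriv M \<Gamma> a c k i j p = 0) \<and>
    (\<forall>p\<in>points M. \<forall>v\<in>tangent_space M p. F p v = a p v v)"

definition special_quadratic_first_integral ::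
    "'p manifold \<Rightarrow> 'p connection \<Rightarrow> ('p \<Rightarrow> 'p tvec \<Rightarrow> real) \<Rightarrow> bool" where
  "special_quadratic_first_integral M \<Gamma> F \<longleftrightarrow>
    (\<exists>a. quadratic_first_integral M \<Gamma> a F \<and> parallel M \<Gamma> a)"

text \<open>Linear independence over \<open>\<real>\<close> of \<open>F 0, \<dots>, F (N - 1)\<close> as functions on the tangent bundle.\<close>

definition linearly_independent ::
    "'p manifold \<Rightarrow> nat \<Rightarrow> (nat \<Rightarrow> 'p \<Rightarrow> 'p tvec \<Rightarrow> real) \<Rightarrow> bool" where
  "linearly_independent M N F \<longleftrightarrow>
    (\<forall>b. (\<forall>p\<in>points M. \<forall>v\<in>tangent_space M p. (\<Sum>k<N. b k * F k p v) = 0) \<longrightarrow>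
      (\<forall>k<N. b k = (0::real)))"

definition M_S :: "nat \<Rightarrow> nat" where
  "M_S m = 1 + (m - 2) * (m - 1) div 2"

lemma M_S_odd: "M_S (2 * n + 1) = 1 + n * (2 * n - 1)"
  by (simp add: M_S_def mult.commute[of n])

end

theory Submission
  imports Defs
begin

text \<open>
  Hyperbolic space \<open>\<real>\<^sup>3\<close> with \<open>g = dx\<^sub>0\<^sup>2 + exp (2 x\<^sub>0) (dx\<^sub>1\<^sup>2 + dx\<^sub>2\<^sup>2)\<close> and \<open>\<xi> = \<partial>\<^sub>0\<close> works, because
  every parallel symmetric tensor field \<open>a\<close> is a constant multiple of \<open>g\<close>, whereas \<open>M\<^sub>S(3) = 2\<close>.
  Indeed \<open>\<partial>\<^sub>0 a\<^sub>0\<^sub>0 = 0\<close> makes \<open>\<partial>\<^sub>k a\<^sub>0\<^sub>0 = 2 a\<^sub>0\<^sub>k\<close> (\<open>k = 1, 2\<close>) independent of \<open>x\<^sub>0\<close>, while \<open>\<partial>\<^sub>0 a\<^sub>0\<^sub>k = a\<^sub>0\<^sub>k\<close>;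
  hence \<open>a\<^sub>0\<^sub>k = 0\<close> and \<open>a\<^sub>0\<^sub>0\<close> is constant. The derivatives of \<open>a\<^sub>0\<^sub>k = 0\<close> then give \<open>a\<^sub>1\<^sub>2 = 0\<close> and
  \<open>a\<^sub>k\<^sub>k = exp (2 x\<^sub>0) a\<^sub>0\<^sub>0\<close>.
\<close>

section \<open>\<open>\<real>\<^sup>m\<close> as a manifold with one chart\<close>

abbreviation RR :: "nat \<Rightarrow> (nat \<Rightarrow> real) set" where
  "RR m \<equiv> topspace (Euclidean_space m)"

lemma upd_in_RR: "u \<in> RR m \<Longrightarrow> i < m \<Longrightarrow> u(i := t) \<in> RR m"
  by (auto simp: topspace_Euclidean_space)

lemma partial_eqI:
  "((\<lambda>t. f (u(i := t))) has_real_derivative D) (at (u i)) \<Longrightarrow> partial i f u = D"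
  unfolding partial_def by (rule DERIV_imp_deriv)

text \<open>A coordinate line in a direction \<open>i < m\<close> through a point of
  \<open>RR m\<close> stays in \<open>RR m\<close>, so values elsewhere do not matter.\<close>

lemma partial_cong_RR:
  assumes "\<And>u. u \<in> RR m \<Longrightarrow> f u = g u" "i < m" "u \<in> RR m"
  shows "partial i f u = partial i g u"
proof -
  have "(\<lambda>t. f (u(i := t))) = (\<lambda>t. g (u(i := t)))"
    using assms upd_in_RR by blast
  then show ?thesis by (simp add: partial_def)
qed

lemma foldr_partial_cong_RR:
  assumes "\<And>u. u \<in> RR m \<Longrightarrow> f u = g u" "set is \<subseteq> {..<m}" "u \<in> RR m"
  shows "foldr partial is f u = foldr partial is g u"
  using assms(2,3)
proof (induction "is" arbitrary: u)
  case (Cons i "is")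
  then show ?case
    by (auto intro!: partial_cong_RR[of m])
qed (use assms(1) in simp)

text \<open>This allows a component of a tensor field to be replaced by a formula that is known only
  on \<open>RR m\<close>.\<close>

lemma smooth_on_RR_cong:
  assumes "\<And>u. u \<in> RR m \<Longrightarrow> f u = g u"
  shows "smooth_on m (RR m) f \<longleftrightarrow> smooth_on m (RR m) g"
proof -
  have *: "smooth_on m (RR m) g"
    if eq: "\<And>u. u \<in> RR m \<Longrightarrow> f u = g u" and f: "smooth_on m (RR m) f" for f g
    unfolding smooth_on_def
  proof (intro allI impI conjI ballI)
    fix "is" assume is_less: "set is \<subseteq> {..<m}"
    have eq': "foldr partial is f u = foldr partial is g u" if "u \<in> RR m" for u
      using foldr_partial_cong_RR[OF eq is_less that] .
    show "continuous_map (subtopology (Euclidean_space m) (RR m)) euclideanreal (foldr partial is g)"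
      by (rule continuous_map_eq[of _ _ "foldr partial is f"])
        (use f is_less eq' in \<open>auto simp: smooth_on_def\<close>)
    fix u i assume u: "u \<in> RR m" and i: "i < m"
    have "(\<lambda>t. foldr partial is g (u(i := t))) = (\<lambda>t. foldr partial is f (u(i := t)))"
      using eq' upd_in_RR[OF u i] by simp
    then show "(\<lambda>t. foldr partial is g (u(i := t))) differentiable at (u i)"
      using f is_less u i by (simp add: smooth_on_def)
  qed
  show ?thesis
    using *[of f g] *[of g f] assms by auto
qed

lemma smooth_on_RR_has_partial:
  assumes "smooth_on m (RR m) f" "u \<in> RR m" "i < m"
  shows "((\<lambda>t. f (u(i := t))) has_real_derivative partial i f u) (at (u i))"
proof -
  have "(\<lambda>t. foldr partial [] f (u(i := t))) differentiable at (u i)"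
    using assms unfolding smooth_on_def by (metis empty_set empty_subsetI)
  then show ?thesis
    unfolding partial_def by (simp add: DERIV_deriv_iff_real_differentiable)
qed

lemma partial_zero_imp_constant_along:
  assumes "smooth_on m (RR m) f" "i < m" "\<And>u. u \<in> RR m \<Longrightarrow> partial i f u = 0" "u \<in> RR m"
  shows "f (u(i := t)) = f u"
proof -
  have "((\<lambda>t. f (u(i := t))) has_real_derivative 0) (at s)" for s
    using smooth_on_RR_has_partial[OF assms(1) upd_in_RR[OF assms(4,2), of s] assms(2)]
      assms(3)[OF upd_in_RR[OF assms(4,2), of s]]
    by simp
  from DERIV_isconst_all[of "\<lambda>t. f (u(i := t))" t "u i"] this show ?thesis by simp
qed

text \<open>For fixed \<open>i\<close>, \<open>j\<close>, \<open>k\<close>, functions of this form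
  are closed under partial differentiation, so one induction over lists of derivatives handles all
  orders. The family contains the coordinates, the constants and the multiples of
  \<open>exp (2 * u 0)\<close>.\<close>

lemma smooth_on_RR_affine_plus_exp:
  "smooth_on m (RR m) (\<lambda>u. a * u i + b + c * exp (k * u j))"
proof -
  define P where "P f \<longleftrightarrow> (\<exists>a b c. f = (\<lambda>u. a * u i + b + c * exp (k * u j)))"
    for f :: "(nat \<Rightarrow> real) \<Rightarrow> real"
  have der: "((\<lambda>t. a * (u(l := t)) i + b + c * exp (k * (u(l := t)) j)) has_real_derivative
      a * (if i = l then 1 else 0) + (c * k * (if j = l then 1 else 0)) * exp (k * u j)) (at (u l))"
    for a b c l u
    by (cases "i = l"; cases "j = l") (auto intro!: derivative_eq_intros)
  \<comment> \<open>The summand \<open>0 * u i\<close> displays the derivative in the form that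
    \<open>P\<close> asks for.\<close>
  have partial: "partial l (\<lambda>u. a * u i + b + c * exp (k * u j)) =
      (\<lambda>u. 0 * u i + a * (if i = l then 1 else 0) + (c * k * (if j = l then 1 else 0)) * exp (k * u j))"
    for a b c l
    by (rule ext, rule partial_eqI) (use der in simp)
  have P_partial: "P (partial l f)" if "P f" for l f
    using that partial unfolding P_def by blast
  have P_foldr: "P (foldr partial is f)" if "P f" for "is" f
    using that by (induction "is") (auto intro: P_partial)
  have cont: "continuous_map (Euclidean_space m) euclideanreal (\<lambda>u. u l)" for l
    unfolding Euclidean_space_def
    by (intro continuous_map_from_subtopology continuous_map_product_projection) simp
  have cont_exp: "continuous_map (Euclidean_space m) euclideanreal (\<lambda>u. exp (k * u j))"
    using continuous_map_compose[OF cont[of j], of euclideanreal "\<lambda>x. exp (k * x)"]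
    by (simp add: o_def continuous_intros)
  have "continuous_map (Euclidean_space m) euclideanreal f" if "P f" for f
    using that cont cont_exp unfolding P_def by (auto intro!: continuous_intros)
  moreover have "(\<lambda>t. f (u(l := t))) differentiable at (u l)" if "P f" for f u l
    using that der unfolding P_def by (blast intro: real_differentiable_def[THEN iffD2])
  moreover have "P (\<lambda>u. a * u i + b + c * exp (k * u j))"
    unfolding P_def by blast
  ultimately show ?thesis
    unfolding smooth_on_def by (simp add: P_foldr)
qed

lemma smooth_on_RR_coord: "smooth_on m (RR m) (\<lambda>u. u i)"
  using smooth_on_RR_affine_plus_exp[of m 1 i 0 0] by simp

lemma smooth_on_RR_const: "smooth_on m (RR m) (\<lambda>u. b)"
  using smooth_on_RR_affine_plus_exp[of m 0 0 b 0] by simp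

lemma smooth_on_RR_exp: "smooth_on m (RR m) (\<lambda>u. c * exp (k * u j))"
  using smooth_on_RR_affine_plus_exp[of m 0 0 0 c] by simp

section \<open>\<open>RR m\<close> with the identity chart\<close>

definition id_chart :: "nat \<Rightarrow> (nat \<Rightarrow> real) chart" where
  "id_chart m = \<lparr>cdom = RR m, cmap = (\<lambda>u. u)\<rparr>"

definition RM :: "nat \<Rightarrow> (nat \<Rightarrow> real) manifold" where
  "RM m = \<lparr>mdim = m, mtop = Euclidean_space m, atlas = {id_chart m}\<rparr>"

lemma RM_simps [simp]:
  "cdom (id_chart m) = RR m" "cmap (id_chart m) = (\<lambda>u. u)"
  "mdim (RM m) = m" "mtop (RM m) = Euclidean_space m" "atlas (RM m) = {id_chart m}"
  by (simp_all add: id_chart_def RM_def)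

lemma cinv_id_chart: "u \<in> RR m \<Longrightarrow> cinv (id_chart m) u = u"
  unfolding cinv_def RM_simps by (rule inv_into_f_eq) auto

text \<open>The inverse chart is known to be the identity on \<open>RR m\<close> only, hence the
  appeal to congruence.\<close>

lemma smooth_on_RM_cinv:
  "smooth_on m (RR m) (f \<circ> cinv (id_chart m)) \<longleftrightarrow> smooth_on m (RR m) f"
  by (rule smooth_on_RR_cong) (simp add: cinv_id_chart)

lemma smooth_fun_RM: "smooth_fun (RM m) (RR m) f \<longleftrightarrow> smooth_on m (RR m) f"
  by (simp add: smooth_fun_def smooth_on_RM_cinv)

lemma pd_id_chart: "p \<in> RR m \<Longrightarrow> i < m \<Longrightarrow> pd (id_chart m) i f p = partial i f p"
  unfolding pd_def RM_simps by (rule partial_cong_RR) (simp_all add: cinv_id_chart)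

text \<open>A countable product of lines has a countable base, and subspaces inherit it.\<close>

lemma second_countable_Euclidean_space: "second_countable (Euclidean_space m)"
proof -
  obtain B :: "(nat \<Rightarrow> real) set set" where "countable B" "topological_basis B"
    using ex_countable_basis by blast
  then have "second_countable (euclidean :: (nat \<Rightarrow> real) topology)"
    unfolding second_countable_def
    by (metis open_openin topological_basisE topological_basis_open)
  then show ?thesis
    unfolding Euclidean_space_def euclidean_product_topology[symmetric]
    by (simp add: second_countable_subtopology euclidean_product_topology)
qed

lemma smooth_manifold_RM: "smooth_manifold (RM m)"
proof -
  have "is_chart m (Euclidean_space m) (id_chart m)"
    using homeomorphic_map_id[of "Euclidean_space m"] by (simp add: is_chart_def id_def)
  moreover have "RR m \<noteq> {}"
    using nontrivial_Euclidean_space by simp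
  ultimately show ?thesis
    by (simp add: smooth_manifold_def Hausdorff_Euclidean_space second_countable_Euclidean_space
        connected_Euclidean_space smooth_on_RM_cinv smooth_on_RR_coord)
qed

section \<open>Tangent vectors through their components\<close>

definition tvec_of :: "nat \<Rightarrow> (nat \<Rightarrow> real) \<Rightarrow> (nat \<Rightarrow> real) \<Rightarrow> (nat \<Rightarrow> real) tvec" where
  "tvec_of m p w = (\<lambda>f. \<Sum>i<m. w i * coord_vec (RM m) (id_chart m) i p f)"

text \<open>A tangent vector is a derivation, so applying it to a coordinate function reads off a
  component. On the tangent space at \<open>p\<close> this inverts \<open>tvec_of m p\<close>, which
  turns identities between operators into identities between numbers.\<close>

definition tcomp :: "(nat \<Rightarrow> real) tvec \<Rightarrow> nat \<Rightarrow> real" where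
  "tcomp v i = v (\<lambda>q. q i)"

lemma partial_coord: "partial i (\<lambda>q. q j) p = (if i = j then 1 else 0)"
  by (rule partial_eqI) (auto intro!: derivative_eq_intros)

lemma coord_vec_coord:
  assumes "p \<in> RR m" "i < m"
  shows "coord_vec (RM m) (id_chart m) i p (\<lambda>q. q j) = (if i = j then 1 else 0)"
proof -
  \<comment> \<open>\<open>coord_vec\<close> takes the default value 0 on functions that are not
    smooth near \<open>p\<close>, so this has to be excluded first.\<close>
  have "smooth_near (RM m) p (\<lambda>q. q j)"
    unfolding smooth_near_def using assms openin_topspace[of "Euclidean_space m"]
    by (metis RM_simps(4) smooth_fun_RM smooth_on_RR_coord)
  then show ?thesis
    using assms by (simp add: coord_vec_def pd_id_chart partial_coord)
qed

lemma tcomp_coord_vec: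
  "p \<in> RR m \<Longrightarrow> i < m \<Longrightarrow> tcomp (coord_vec (RM m) (id_chart m) i p) j = (if i = j then 1 else 0)"
  by (simp add: tcomp_def coord_vec_coord)

lemma tcomp_tvec_of:
  assumes "p \<in> RR m" "i < m"
  shows "tcomp (tvec_of m p w) i = w i"
proof -
  have "tcomp (tvec_of m p w) i = (\<Sum>j<m. w j * (if j = i then 1 else 0))"
    using assms by (simp add: tcomp_def tvec_of_def coord_vec_coord)
  also have "\<dots> = w i"
    using assms by (simp add: if_distrib sum.delta cong: if_cong)
  finally show ?thesis .
qed

lemma tcomp_lincomb: "tcomp (lincomb r v s w) i = r * tcomp v i + s * tcomp w i"
  by (simp add: tcomp_def lincomb_def)

lemma tangent_space_RM: "p \<in> RR m \<Longrightarrow> tangent_space (RM m) p = range (tvec_of m p)"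
  by (auto simp: tangent_space_def tvec_of_def[abs_def])

lemma tvec_of_in_tangent_space: "p \<in> RR m \<Longrightarrow> tvec_of m p w \<in> tangent_space (RM m) p"
  by (simp add: tangent_space_RM)

lemma tvec_of_cong: "(\<And>i. i < m \<Longrightarrow> w i = w' i) \<Longrightarrow> tvec_of m p w = tvec_of m p w'"
  by (simp add: tvec_of_def)

lemma tvec_of_tcomp:
  assumes "p \<in> RR m" "v \<in> tangent_space (RM m) p"
  shows "tvec_of m p (tcomp v) = v"
  using assms by (auto simp: tangent_space_RM tcomp_tvec_of intro: tvec_of_cong)

lemma lincomb_tvec_of:
  "lincomb r (tvec_of m p w) s (tvec_of m p w') = tvec_of m p (\<lambda>i. r * w i + s * w' i)"
  by (simp add: lincomb_def tvec_of_def sum_distrib_left sum.distrib algebra_simps)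

lemma tvec_of_zero: "tvec_of m p (\<lambda>i. 0) = (\<lambda>_. 0)"
  by (simp add: tvec_of_def)

lemma coord_vec_eq_tvec_of:
  assumes "i < m"
  shows "coord_vec (RM m) (id_chart m) i p = tvec_of m p (\<lambda>j. if j = i then 1 else 0)"
proof
  fix f
  have "tvec_of m p (\<lambda>j. if j = i then 1 else 0) f =
      (\<Sum>j<m. if j = i then coord_vec (RM m) (id_chart m) j p f else 0)"
    unfolding tvec_of_def by (rule sum.cong) auto
  then show "coord_vec (RM m) (id_chart m) i p f = tvec_of m p (\<lambda>j. if j = i then 1 else 0) f"
    using assms by simp
qed

text \<open>The definition provides linearity for two-term combinations in the first argument.
  Induction extends it to \<open>m\<close> terms, and symmetry carries it to the second
  argument.\<close>

lemma bilinear_tvec_of: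
  assumes a: "symmetric_tensor_field_02 (RM m) a" and p: "p \<in> RR m"
  shows "a p (tvec_of m p v) (tvec_of m p w) =
    (\<Sum>i<m. \<Sum>j<m. v i * w j * comp02 (RM m) a (id_chart m) i j p)"
proof -
  let ?e = "\<lambda>i. coord_vec (RM m) (id_chart m) i p"
  have sym: "a p x y = a p y x"
    if "x \<in> range (tvec_of m p)" "y \<in> range (tvec_of m p)" for x y
    using a p that by (auto simp: symmetric_tensor_field_02_def tangent_space_RM)
  have lin: "a p (lincomb r x s y) z = r * a p x z + s * a p y z"
    if "x \<in> range (tvec_of m p)" "y \<in> range (tvec_of m p)" "z \<in> range (tvec_of m p)" for r s x y z
    using a p that unfolding symmetric_tensor_field_02_def tangent_space_RM[OF p]
    by (metis RM_simps(4) tangent_space_RM)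
  have e: "?e i \<in> range (tvec_of m p)" if "i < m" for i
    using coord_vec_eq_tvec_of[OF that] by auto
  have expand: "a p (tvec_of m p v) z = (\<Sum>i<m. v i * a p (?e i) z)"
    if z: "z \<in> range (tvec_of m p)" for v z
  proof -
    \<comment> \<open>Induction on the number \<open>k\<close> of components that are kept, the
      others being set to 0.\<close>
    have "a p (tvec_of m p (\<lambda>i. if i < k then v i else 0)) z = (\<Sum>i<k. v i * a p (?e i) z)"
      if "k \<le> m" for k
      using that
    proof (induction k)
      case 0
      \<comment> \<open>The zero vector is the combination of \<open>z\<close> with itself in which
        both coefficients are 0.\<close>
      show ?case
        using lin[OF z z z, of 0 0] by (simp add: lincomb_def tvec_of_zero)
    next
      case (Suc k)
      have "tvec_of m p (\<lambda>i. if i < Suc k then v i else 0) =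
          lincomb 1 (tvec_of m p (\<lambda>i. if i < k then v i else 0)) (v k) (?e k)"
        using Suc.prems by (auto simp: coord_vec_eq_tvec_of lincomb_tvec_of less_Suc_eq intro!: tvec_of_cong)
      then show ?case
        using Suc lin[OF _ e z] by simp
    qed
    from this[OF order_refl] show ?thesis
      by (simp cong: tvec_of_cong)
  qed
  have "a p (tvec_of m p v) (tvec_of m p w) = (\<Sum>i<m. v i * a p (tvec_of m p w) (?e i))"
    using expand[of "tvec_of m p w" v] sym e by simp
  also have "\<dots> = (\<Sum>i<m. v i * (\<Sum>j<m. w j * a p (?e i) (?e j)))"
  proof (intro sum.cong refl arg_cong2[where f = "(*)"])
    fix i assume "i \<in> {..<m}"
    then have i: "?e i \<in> range (tvec_of m p)" by (simp add: e)
    have "a p (?e j) (?e i) = a p (?e i) (?e j)" if "j < m" for j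
      using sym[OF e[OF that] i] .
    then show "a p (tvec_of m p w) (?e i) = (\<Sum>j<m. w j * a p (?e i) (?e j))"
      unfolding expand[OF i] by (intro sum.cong) auto
  qed
  finally show ?thesis
    by (simp add: comp02_def sum_distrib_left mult.assoc)
qed

section \<open>Hyperbolic space as an almost contact metric manifold\<close>

definition hyp_diag :: "nat \<Rightarrow> (nat \<Rightarrow> real) \<Rightarrow> real" where
  "hyp_diag i p = (if i = 0 then 1 else exp (2 * p 0))"

definition hyp_g :: "(nat \<Rightarrow> real) \<Rightarrow> (nat \<Rightarrow> real) tvec \<Rightarrow> (nat \<Rightarrow> real) tvec \<Rightarrow> real" where
  "hyp_g p v w = (\<Sum>i<3. hyp_diag i p * tcomp v i * tcomp w i)"

text \<open>A quarter turn in the plane of the directions 1 and 2. The metric scales both by the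
  same factor, so the turn is an isometry of that plane.\<close>

definition hyp_phi :: "(nat \<Rightarrow> real) \<Rightarrow> (nat \<Rightarrow> real) tvec \<Rightarrow> (nat \<Rightarrow> real) tvec" where
  "hyp_phi p v = tvec_of 3 p (\<lambda>i. if i = 1 then - tcomp v 2 else if i = 2 then tcomp v 1 else 0)"

definition hyp_xi :: "(nat \<Rightarrow> real) \<Rightarrow> (nat \<Rightarrow> real) tvec" where
  "hyp_xi p = tvec_of 3 p (\<lambda>i. if i = 0 then 1 else 0)"

definition hyp_eta :: "(nat \<Rightarrow> real) \<Rightarrow> (nat \<Rightarrow> real) tvec \<Rightarrow> real" where
  "hyp_eta p v = tcomp v 0"

text \<open>The Christoffel symbols of \<open>hyp_g\<close>: half the derivative of
  \<open>exp (2 * p 0)\<close> is \<open>exp (2 * p 0)\<close> itself, which appears with a minus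
  sign for the upper index 0 and is divided by \<open>exp (2 * p 0)\<close> for the upper indices 1
  and 2.\<close>

definition hyp_Gamma :: "(nat \<Rightarrow> real) connection" where
  "hyp_Gamma c k i j p =
    (if k = 0 \<and> i = j \<and> i \<noteq> 0 then - exp (2 * p 0)
     else if k \<noteq> 0 \<and> (i = 0 \<and> j = k \<or> j = 0 \<and> i = k) then 1 else 0)"

lemma less_3_cases: "i < (3::nat) \<longleftrightarrow> i = 0 \<or> i = 1 \<or> i = 2"
  by auto

lemma sum_3: "(\<Sum>i<3. f i) = f 0 + f 1 + f (2::nat)"
  by (simp add: numeral_3_eq_3 numeral_2_eq_2)

text \<open>The factor \<open>b\<close> absorbs the Kronecker delta in the components of
  \<open>hyp_g\<close>.\<close>

lemma smooth_hyp_diag: "smooth_on m (RR m) (\<lambda>p. b * hyp_diag i p)"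
  by (cases "i = 0") (use smooth_on_RR_exp[of m b 2 0] in \<open>simp_all add: hyp_diag_def smooth_on_RR_const\<close>)

lemma comp02_hyp_g:
  assumes "p \<in> RR 3" "i < 3" "j < 3"
  shows "comp02 (RM 3) hyp_g (id_chart 3) i j p = (if i = j then 1 else 0) * hyp_diag i p"
  using assms(2,3)
  by (auto simp: comp02_def hyp_g_def tcomp_coord_vec[OF assms(1)] sum_3 less_3_cases)

lemma symmetric_hyp_g: "symmetric_tensor_field_02 (RM 3) hyp_g"
  unfolding symmetric_tensor_field_02_def
proof (intro conjI ballI allI impI)
  fix c i j assume "c \<in> atlas (RM 3)" and i: "i < mdim (RM 3)" and j: "j < mdim (RM 3)"
  have "smooth_on 3 (RR 3) (comp02 (RM 3) hyp_g (id_chart 3) i j) \<longleftrightarrow>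
      smooth_on 3 (RR 3) (\<lambda>p. (if i = j then 1 else 0) * hyp_diag i p)"
    using i j comp02_hyp_g by (intro smooth_on_RR_cong) simp
  then show "smooth_fun (RM 3) (cdom c) (comp02 (RM 3) hyp_g c i j)"
    using \<open>c \<in> _\<close> smooth_hyp_diag by (simp add: smooth_fun_RM del: mult_if_delta)
qed (simp_all add: hyp_g_def sum_3 tcomp_lincomb algebra_simps)

text \<open>In components this is a sum of squares with positive weights, and a nonzero tangent
  vector has a nonzero component because its components determine it.\<close>

lemma riemannian_hyp_g: "riemannian_metric (RM 3) hyp_g"
  unfolding riemannian_metric_def
proof (intro conjI ballI impI)
  show "symmetric_tensor_field_02 (RM 3) hyp_g" by (rule symmetric_hyp_g)
  fix p v assume p: "p \<in> points (RM 3)" and v: "v \<in> tangent_space (RM 3) p" "v \<noteq> (\<lambda>_. 0)"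
  have "\<exists>i<3. tcomp v i \<noteq> 0"
  proof (rule ccontr)
    assume "\<not> ?thesis"
    then have "tvec_of 3 p (tcomp v) = tvec_of 3 p (\<lambda>i. 0)"
      by (intro tvec_of_cong) auto
    then show False
      using p v tvec_of_tcomp[of p 3 v] by (simp add: tvec_of_zero)
  qed
  then obtain i where i: "i < 3" "tcomp v i \<noteq> 0" by blast
  have pos: "0 < hyp_diag j p" for j by (simp add: hyp_diag_def)
  have "hyp_g p v v = (\<Sum>j<3. hyp_diag j p * (tcomp v j)\<^sup>2)"
    by (simp add: hyp_g_def power2_eq_square mult.assoc)
  also have "\<dots> > 0"
    by (rule sum_pos2[of _ i]) (use i pos in \<open>simp_all add: less_imp_le\<close>)
  finally show "hyp_g p v v > 0" .
qed

lemma almost_contact_hyp: "almost_contact_metric_manifold 1 (RM 3) hyp_phi hyp_xi hyp_eta hyp_g"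
proof -
  have phi: "tensor_field_11 (RM 3) hyp_phi"
    unfolding tensor_field_11_def
  proof (intro conjI ballI allI impI)
    fix c i j assume c: "c \<in> atlas (RM 3)" and ij: "i < mdim (RM 3)" "j < mdim (RM 3)"
    have "smooth_on 3 (RR 3) (\<lambda>p. hyp_phi p (coord_vec (RM 3) (id_chart 3) j p) (\<lambda>q. q i)) \<longleftrightarrow>
      smooth_on 3 (RR 3) (\<lambda>p. if i = 1 \<and> j = 2 then - 1 else if i = 2 \<and> j = 1 then 1 else 0)"
    proof (rule smooth_on_RR_cong)
      fix p assume p: "p \<in> RR 3"
      have "hyp_phi p (coord_vec (RM 3) (id_chart 3) j p) (\<lambda>q. q i) =
        tcomp (hyp_phi p (coord_vec (RM 3) (id_chart 3) j p)) i"
        by (simp add: tcomp_def)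
      then show "hyp_phi p (coord_vec (RM 3) (id_chart 3) j p) (\<lambda>q. q i) =
        (if i = 1 \<and> j = 2 then - 1 else if i = 2 \<and> j = 1 then 1 else 0)"
        using ij p by (auto simp: hyp_phi_def tcomp_tvec_of tcomp_coord_vec)
    qed
    then show "smooth_fun (RM 3) (cdom c) (\<lambda>p. hyp_phi p (coord_vec (RM 3) c j p) (coord c i))"
      using c by (simp add: smooth_fun_RM smooth_on_RR_const)
  qed (auto simp: hyp_phi_def tvec_of_in_tangent_space lincomb_tvec_of tcomp_lincomb intro!: tvec_of_cong)
  have xi: "vector_field (RM 3) hyp_xi"
    unfolding vector_field_def
  proof (intro conjI ballI allI impI)
    fix c i assume c: "c \<in> atlas (RM 3)" and i: "i < mdim (RM 3)"
    have "smooth_on 3 (RR 3) (\<lambda>p. hyp_xi p (\<lambda>q. q i)) \<longleftrightarrow>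
      smooth_on 3 (RR 3) (\<lambda>p. if i = 0 then 1 else 0)"
    proof (rule smooth_on_RR_cong)
      fix p assume p: "p \<in> RR 3"
      show "hyp_xi p (\<lambda>q. q i) = (if i = 0 then 1 else 0)"
        using i p tcomp_tvec_of[of p 3 i] by (simp add: hyp_xi_def tcomp_def)
    qed
    then show "smooth_fun (RM 3) (cdom c) (\<lambda>p. hyp_xi p (coord c i))"
      using c by (simp add: smooth_fun_RM smooth_on_RR_const)
  qed (simp add: hyp_xi_def tvec_of_in_tangent_space)
  have eta: "one_form (RM 3) hyp_eta"
    unfolding one_form_def
  proof (intro conjI ballI allI impI)
    fix c i assume c: "c \<in> atlas (RM 3)" and i: "i < mdim (RM 3)"
    have "smooth_on 3 (RR 3) (\<lambda>p. hyp_eta p (coord_vec (RM 3) (id_chart 3) i p)) \<longleftrightarrow>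
      smooth_on 3 (RR 3) (\<lambda>p. if i = 0 then 1 else 0)"
      using i by (intro smooth_on_RR_cong) (simp add: hyp_eta_def tcomp_coord_vec)
    then show "smooth_fun (RM 3) (cdom c) (\<lambda>p. hyp_eta p (coord_vec (RM 3) c i p))"
      using c by (simp add: smooth_fun_RM smooth_on_RR_const)
  qed (simp add: hyp_eta_def tcomp_lincomb)
  have id: "hyp_phi p (hyp_phi p X) = lincomb (- 1) X (hyp_eta p X) (hyp_xi p) \<and>
        hyp_eta p (hyp_phi p X) = 0 \<and> hyp_eta p X = hyp_g p X (hyp_xi p) \<and>
        hyp_g p (hyp_phi p X) (hyp_phi p Y) = hyp_g p X Y - hyp_eta p X * hyp_eta p Y"
    if p: "p \<in> RR 3" and X: "X \<in> tangent_space (RM 3) p" and Y: "Y \<in> tangent_space (RM 3) p" for p X Y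
  proof (intro conjI)
    \<comment> \<open>Writing \<open>X\<close> through its components makes both sides values of
      \<open>tvec_of 3 p\<close>, to be compared index by index.\<close>
    have "lincomb (- 1) (tvec_of 3 p (tcomp X)) (hyp_eta p X) (hyp_xi p) = hyp_phi p (hyp_phi p X)"
      unfolding hyp_xi_def hyp_phi_def lincomb_tvec_of hyp_eta_def
      by (rule tvec_of_cong) (auto simp: tcomp_tvec_of[OF p] less_3_cases)
    then show "hyp_phi p (hyp_phi p X) = lincomb (- 1) X (hyp_eta p X) (hyp_xi p)"
      using tvec_of_tcomp[OF p X] by simp
  qed (simp_all add: hyp_phi_def hyp_xi_def hyp_eta_def hyp_g_def hyp_diag_def sum_3
      tcomp_tvec_of[OF p])
  have "hyp_eta p (hyp_xi p) = 1 \<and> hyp_phi p (hyp_xi p) = (\<lambda>_. 0)" if p: "p \<in> RR 3" for p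
  proof
    have "hyp_phi p (hyp_xi p) = tvec_of 3 p (\<lambda>_. 0)"
      unfolding hyp_phi_def hyp_xi_def
      by (rule tvec_of_cong) (simp add: tcomp_tvec_of[OF p])
    then show "hyp_phi p (hyp_xi p) = (\<lambda>_. 0)"
      by (simp add: tvec_of_zero)
  qed (simp add: hyp_eta_def hyp_xi_def tcomp_tvec_of[OF p])
  with id phi xi eta riemannian_hyp_g smooth_manifold_RM[of 3] show ?thesis
    by (simp add: almost_contact_metric_manifold_def)
qed

section \<open>The Levi-Civita connection\<close>

lemma smooth_hyp_Gamma: "smooth_on m (RR m) (hyp_Gamma c k i j)"
proof -
  have "hyp_Gamma c k i j = (\<lambda>p. - 1 * exp (2 * p 0)) \<or> (\<exists>b. hyp_Gamma c k i j = (\<lambda>p. b))"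
    unfolding hyp_Gamma_def[abs_def] by (auto simp: fun_eq_iff)
  then show ?thesis
    using smooth_on_RR_exp[of m "- 1" 2 0] smooth_on_RR_const by auto
qed

lemma partial_hyp_diag:
  "partial k (\<lambda>p. b * hyp_diag i p) p = (if k = 0 \<and> i \<noteq> 0 then 2 * b * exp (2 * p 0) else 0)"
  by (rule partial_eqI; cases "i = 0"; cases "k = 0")
    (auto simp: hyp_diag_def intro!: derivative_eq_intros)

lemma cov_deriv_RM:
  assumes "p \<in> RR 3" "k < 3"
  shows "cov_deriv (RM 3) \<Gamma> a (id_chart 3) i j k p =
    partial k (comp02 (RM 3) a (id_chart 3) i j) p
    - (\<Sum>l<3. \<Gamma> (id_chart 3) l k i p * comp02 (RM 3) a (id_chart 3) l j p)
    - (\<Sum>l<3. \<Gamma> (id_chart 3) l k j p * comp02 (RM 3) a (id_chart 3) i l p)"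
  using assms by (simp add: cov_deriv_def pd_id_chart)

lemma levi_civita_hyp: "levi_civita_connection (RM 3) hyp_g hyp_Gamma"
proof -
  have "parallel (RM 3) hyp_Gamma hyp_g"
    unfolding parallel_def
  proof (intro ballI allI impI)
    fix c p i j k
    assume "c \<in> atlas (RM 3)" "p \<in> cdom c" and i: "i < mdim (RM 3)" and j: "j < mdim (RM 3)"
      and k: "k < mdim (RM 3)"
    then have c: "c = id_chart 3" and p: "p \<in> RR 3" by auto
    have "partial k (comp02 (RM 3) hyp_g (id_chart 3) i j) p =
      partial k (\<lambda>p. (if i = j then 1 else 0) * hyp_diag i p) p"
      by (rule partial_cong_RR[of 3]) (use i j k p comp02_hyp_g in simp_all)
    then have *: "partial k (comp02 (RM 3) hyp_g (id_chart 3) i j) p =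
      (if k = 0 \<and> i \<noteq> 0 then 2 * (if i = j then 1 else 0) * exp (2 * p 0) else 0)"
      by (simp only: partial_hyp_diag)
    show "cov_deriv (RM 3) hyp_Gamma hyp_g c i j k p = 0"
      using i j k unfolding c
      by (auto simp: cov_deriv_RM[OF p] * comp02_hyp_g[OF p] sum_3 less_3_cases hyp_Gamma_def hyp_diag_def)
  qed
  \<comment> \<open>The only change of coordinates is the identity: its Jacobian is the unit matrix
    and its second derivatives vanish.\<close>
  moreover have "linear_connection (RM 3) hyp_Gamma"
  proof -
    have 1: "pd (id_chart 3) i (\<lambda>q. q j) p = (if i = j then 1 else 0)" if "p \<in> RR 3" "i < 3" for i j p
      using that by (simp add: pd_id_chart partial_coord)
    have "pd (id_chart 3) i (pd (id_chart 3) j (\<lambda>q. q l)) p = 0"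
      if "p \<in> RR 3" "i < 3" "j < 3" for i j l p
    proof -
      have "pd (id_chart 3) i (pd (id_chart 3) j (\<lambda>q. q l)) p = partial i (\<lambda>q. if j = l then 1 else 0) p"
        unfolding pd_id_chart[OF that(1,2)] by (rule partial_cong_RR[of 3]) (use that 1 in simp_all)
      also have "\<dots> = 0"
        by (rule partial_eqI) simp
      finally show ?thesis .
    qed
    with 1 show ?thesis
      by (auto simp: linear_connection_def smooth_fun_RM smooth_hyp_Gamma sum_3 less_3_cases)
  qed
  moreover have "\<forall>c k i j p. hyp_Gamma c k i j p = hyp_Gamma c k j i p"
    by (auto simp: hyp_Gamma_def)
  ultimately show ?thesis
    by (simp add: levi_civita_connection_def symmetric_connection_def)
qed

section \<open>Parallel tensors of hyperbolic space\<close>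

text \<open>The diagonal values \<open>a p v v\<close> suffice, as they are what a first integral
  sees. The constant is the value of \<open>A 0 0\<close> at the origin.\<close>

lemma parallel_hyp_proportional:
  assumes a: "symmetric_tensor_field_02 (RM 3) a" and par: "parallel (RM 3) hyp_Gamma a"
  obtains \<kappa> where "\<And>p v. p \<in> RR 3 \<Longrightarrow> v \<in> tangent_space (RM 3) p \<Longrightarrow> a p v v = \<kappa> * hyp_g p v v"
proof -
  define A where "A = comp02 (RM 3) a (id_chart 3)"
  have smooth: "smooth_on 3 (RR 3) (A i j)" if "i < 3" "j < 3" for i j
    using a that by (simp add: symmetric_tensor_field_02_def A_def smooth_fun_RM)
  have sym: "A i j p = A j i p" if "p \<in> RR 3" "i < 3" "j < 3" for i j p
    using a that by (simp add: symmetric_tensor_field_02_def A_def comp02_def coord_vec_eq_tvec_of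
        tvec_of_in_tangent_space)
  have partial: "partial k (A i j) p =
      (\<Sum>l<3. hyp_Gamma (id_chart 3) l k i p * A l j p) + (\<Sum>l<3. hyp_Gamma (id_chart 3) l k j p * A i l p)"
    if "p \<in> RR 3" "i < 3" "j < 3" "k < 3" for i j k p
    using par that cov_deriv_RM[of p k hyp_Gamma a i j] by (simp add: parallel_def A_def)
  have vanish: "partial k f p = 0" if "\<And>p. p \<in> RR 3 \<Longrightarrow> f p = 0" "p \<in> RR 3" "k < 3" for f k p
    using partial_cong_RR[of 3 f "\<lambda>p. 0" k p] that partial_eqI[of "\<lambda>p. 0" p k 0] by simp
  \<comment> \<open>All coefficients with both lower indices 0 vanish, so the derivative of
    \<open>A 0 0\<close> in direction 0 is 0.\<close>
  have A00: "A 0 0 (u(0 := t)) = A 0 0 u" if "u \<in> RR 3" for u t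
    by (rule partial_zero_imp_constant_along[of 3])
      (use smooth that partial in \<open>simp_all add: sum_3 hyp_Gamma_def\<close>)
  have A0k: "A 0 k u = 0" if u: "u \<in> RR 3" and k: "k = 1 \<or> k = 2" for u k
  proof -
    have half: "partial k (A 0 0) p = 2 * A 0 k p" if "p \<in> RR 3" for p
      using partial[OF that, of 0 0 k] sym[OF that, of k 0] k by (auto simp: sum_3 hyp_Gamma_def)
    \<comment> \<open>Since \<open>k\<close> is not 0, the two updates commute, and independence of
      the coordinate 0 passes from \<open>A 0 0\<close> to its derivative.\<close>
    have "partial k (A 0 0) (u(0 := t)) = partial k (A 0 0) u" for t
    proof -
      have "A 0 0 (u(0 := t, k := s)) = A 0 0 (u(k := s))" for s
        using A00[OF upd_in_RR[OF u, of k s], of t] k by (auto simp: fun_upd_twist)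
      then show ?thesis
        using k by (auto simp: partial_def)
    qed
    then have "A 0 k (u(0 := t)) = A 0 k u" for t
      using half u upd_in_RR[OF u] by simp
    then have "partial 0 (A 0 k) u = 0"
      by (intro partial_eqI) simp
    \<comment> \<open>The system also says that the derivative of \<open>A 0 k\<close> in direction
      0 is \<open>A 0 k\<close> itself.\<close>
    then show ?thesis
      using partial[OF u, of 0 k 0] k by (auto simp: sum_3 hyp_Gamma_def)
  qed
  \<comment> \<open>The derivative of \<open>A 0 k\<close> in direction \<open>k\<close> equals
    \<open>A k k u - exp (2 * u 0) * A 0 0 u\<close>.\<close>
  have Akk: "A k k u = exp (2 * u 0) * A 0 0 u" if u: "u \<in> RR 3" and k: "k = 1 \<or> k = 2" for u k
    using vanish[of "A 0 k" u k] A0k u k partial[OF u, of 0 k k] by (auto simp: sum_3 hyp_Gamma_def)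
  have A12: "A 1 2 u = 0" if u: "u \<in> RR 3" for u
    using vanish[of "A 0 2" u 1] A0k u partial[OF u, of 0 2 1] by (auto simp: sum_3 hyp_Gamma_def)
  have dA00: "partial k (A 0 0) u = 0" if "u \<in> RR 3" "k < 3" for u k
    using partial[OF that(1), of 0 0 k] A0k[OF that(1)] sym[OF that(1), of 1 0] sym[OF that(1), of 2 0] that(2)
    by (auto simp: sum_3 hyp_Gamma_def less_3_cases)
  have const: "A 0 0 (u(k := t)) = A 0 0 u" if "u \<in> RR 3" "k < 3" for u k t
    by (rule partial_zero_imp_constant_along[of 3])
      (use smooth that dA00 in simp_all)
  have A00_const: "A 0 0 u = A 0 0 (\<lambda>_. 0)" if u: "u \<in> RR 3" for u
  proof -
    \<comment> \<open>Points of \<open>RR 3\<close> vanish at all indices from 3 on, so three moves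
      along coordinate lines lead to the origin.\<close>
    have "u(0 := 0, 1 := 0, 2 := 0) = (\<lambda>_. 0)"
      using u by (auto simp: topspace_Euclidean_space fun_eq_iff eval_nat_numeral not_less_eq_eq)
    then show ?thesis
      using const u upd_in_RR[of _ 3] by (metis less_3_cases)
  qed
  show thesis
  proof
    fix p v assume p: "p \<in> RR 3" and v: "v \<in> tangent_space (RM 3) p"
    have "a p v v = (\<Sum>i<3. \<Sum>j<3. tcomp v i * tcomp v j * A i j p)"
      using bilinear_tvec_of[OF a p, of "tcomp v" "tcomp v"] tvec_of_tcomp[OF p v] by (simp add: A_def)
    also have "\<dots> = A 0 0 p * hyp_g p v v"
      using A0k[OF p] A12[OF p] Akk[OF p] sym[OF p]
      by (simp add: sum_3 hyp_g_def hyp_diag_def algebra_simps)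
    finally show "a p v v = A 0 0 (\<lambda>_. 0) * hyp_g p v v"
      using A00_const[OF p] by simp
  qed
qed

section \<open>Two special first integrals are always dependent\<close>

theorem proposition5:
  shows "\<exists>n (M :: (nat \<Rightarrow> real) manifold) \<phi> \<xi> \<eta> g \<Gamma>.
    n \<ge> 1 \<and>
    almost_contact_metric_manifold n M \<phi> \<xi> \<eta> g \<and>
    levi_civita_connection M g \<Gamma> \<and>
    \<not> (\<exists>F. (\<forall>k<M_S (2 * n + 1). special_quadratic_first_integral M \<Gamma> (F k)) \<and>
           linearly_independent M (M_S (2 * n + 1)) F)"
proof -
  have "\<not> linearly_independent (RM 3) 2 F"
    if F: "\<forall>k<2. special_quadratic_first_integral (RM 3) hyp_Gamma (F k)" for F
  proof
    assume ind: "linearly_independent (RM 3) 2 F"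
    have "\<exists>\<kappa>. \<forall>p\<in>RR 3. \<forall>v\<in>tangent_space (RM 3) p. F k p v = \<kappa> * hyp_g p v v" if "k < 2" for k
    proof -
      obtain a where "quadratic_first_integral (RM 3) hyp_Gamma a (F k)" "parallel (RM 3) hyp_Gamma a"
        using F \<open>k < 2\<close> by (auto simp: special_quadratic_first_integral_def)
      moreover from this obtain \<kappa> where
        "\<And>p v. p \<in> RR 3 \<Longrightarrow> v \<in> tangent_space (RM 3) p \<Longrightarrow> a p v v = \<kappa> * hyp_g p v v"
        using parallel_hyp_proportional by (auto simp: quadratic_first_integral_def)
      ultimately show ?thesis
        by (auto simp: quadratic_first_integral_def)
    qed
    then obtain \<kappa> where \<kappa>:
      "\<And>k p v. k < 2 \<Longrightarrow> p \<in> RR 3 \<Longrightarrow> v \<in> tangent_space (RM 3) p \<Longrightarrow> F k p v = \<kappa> k * hyp_g p v v"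
      by metis
    have dep: "b 0 = 0 \<and> b 1 = 0" if "b 0 * \<kappa> 0 + b 1 * \<kappa> 1 = 0" for b :: "nat \<Rightarrow> real"
    proof -
      have "(\<Sum>k<2. b k * F k p v) = 0" if "p \<in> RR 3" "v \<in> tangent_space (RM 3) p" for p v
      proof -
        have "(\<Sum>k<2. b k * F k p v) = (b 0 * \<kappa> 0 + b 1 * \<kappa> 1) * hyp_g p v v"
          using \<kappa>[OF _ that] by (simp add: numeral_2_eq_2 algebra_simps)
        then show ?thesis
          using \<open>b 0 * \<kappa> 0 + b 1 * \<kappa> 1 = 0\<close> by simp
      qed
      then show ?thesis
        using ind by (simp add: linearly_independent_def)
    qed
    \<comment> \<open>The coefficients \<open>\<kappa> 1\<close> and \<open>- \<kappa> 0\<close>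
      always give a relation, so independence forces both constants to be 0. Then the coefficients 1
      and 1 give a relation too, which is absurd.\<close>
    show False
      using dep[of "\<lambda>k. if k = 0 then \<kappa> 1 else - \<kappa> 0"] dep[of "\<lambda>k. 1"] by simp
  qed
  moreover have "M_S (2 * 1 + 1) = 2"
    by (simp add: M_S_def)
  ultimately show ?thesis
    using almost_contact_hyp levi_civita_hyp by (metis order_refl)
qed

end
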